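(* There is a function $\varepsilon(\Delta)$ with $\varepsilon(\Delta) \to 0$ as $\Delta \to \infty$ such that the following holds: for every $\Delta$ and every integer $k > \log \Delta \log\log \Delta$, and every finite graph $G$ with maximum degree $\Delta(G) \leq \Delta$, \[ L_k(G) \geq \frac{k\,|V(G)|}{\Delta}\bigl(1 - \varepsilon(\Delta)\bigr). \] That is, $L_k(G) \geq \frac{k|V(G)|}{\Delta}(1+o(1))$ as $\Delta \to \infty$.
   Context: Here $\log$ is the natural logarithm. For a graph $G$ and vertex $v$, $N[v] = \{v\} \cup N(v)$ is the closed neighbourhood of $v$. For $k \geq 1$, a set $X \subseteq V(G)$ is a $k$-limited packing if $|N[v] \cap X| \leq k$ for every $v \in V(G)$. The $k$-limited packing number $L_k(G)$ is the maximum cardinality of a $k$-limited packing in $G$.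
   Formalization: Only k ≤ Δ+1 is covered: with no upper bound on k the claim fails (one isolated vertex, k > 2Δ, gives L_k = 1 while the right side exceeds 1); for k ≥ Δ+1, L_k(G) = |V(G)|. Vertices are natural numbers, which covers every finite graph up to isomorphism. *)

theory Defs
  imports Complex_Main "Graph_Theory.Pair_Digraph"
begin

text \<open>A finite simple graph is a pair_graph: a finite, loopless digraph with a symmetric arc
  relation. Each edge uv is present as the two arcs (u, v) and (v, u), so the degree of a vertex
  is its out-degree.\<close>

definition max_degree :: "'a pair_pre_digraph \<Rightarrow> nat" where
  "max_degree G = Max (insert 0 (out_degree (with_proj G) ` pverts G))"

definition closed_nbhd :: "'a pair_pre_digraph \<Rightarrow> 'a \<Rightarrow> 'a set" where
  "closed_nbhd G v = insert v {u. (v, u) \<in> parcs G}"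

definition limited_packing :: "nat \<Rightarrow> 'a pair_pre_digraph \<Rightarrow> 'a set \<Rightarrow> bool" where
  "limited_packing k G X \<longleftrightarrow>
     X \<subseteq> pverts G \<and> (\<forall>v\<in>pverts G. card (closed_nbhd G v \<inter> X) \<le> k)"

text \<open>On a finite graph the maximum is over a finite set, nonempty because of the empty packing.\<close>

definition limited_packing_number :: "nat \<Rightarrow> 'a pair_pre_digraph \<Rightarrow> nat" where
  "limited_packing_number k G = Max {card X | X. limited_packing k G X}"

end

theory Submission
  imports Defs "HOL-Real_Asymp.Real_Asymp"
begin

text \<open>Alteration method. Put each vertex into a random set \<open>X\<close> independently with probability
  \<open>p = k (1 - 2 \<delta>) / (\<Delta> + 1)\<close>, and delete from \<open>X\<close> the whole closed neighbourhood of each vertex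
  \<open>v\<close> with \<open>|N[v] \<inter> X| > k\<close>. By a Chernoff bound a given vertex is that bad with probability at
  most \<open>exp (- k \<delta>\<^sup>2)\<close>, so the resulting packing has expected size at least
  \<open>n (p - (\<Delta> + 1) exp (- k \<delta>\<^sup>2))\<close>. With \<open>\<delta> = (ln ln \<Delta>) powr (-1/4)\<close> and \<open>k > ln \<Delta> ln ln \<Delta>\<close> the
  deletion term is at most \<open>(\<Delta> + 1) exp (- ln \<Delta> sqrt (ln ln \<Delta>))\<close>, which is smaller than every
  power of \<open>\<Delta>\<close>.\<close>

section \<open>Random subsets: moments and a tail bound\<close>

text \<open>Probability of the outcome \<open>X\<close> when points of \<open>V\<close> are kept
  independently with probability \<open>p\<close>; expectations are then finite sums over
  \<open>Pow V\<close>.\<close>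

definition bernoulli_weight :: "real \<Rightarrow> 'a set \<Rightarrow> 'a set \<Rightarrow> real" where
  "bernoulli_weight p V X = p ^ card X * (1 - p) ^ card (V - X)"

lemma bernoulli_weight_nonneg: "0 \<le> p \<Longrightarrow> p \<le> 1 \<Longrightarrow> 0 \<le> bernoulli_weight p V X"
  by (simp add: bernoulli_weight_def)

text \<open>Independence factors the expectation over the points of \<open>V\<close>, and points
  outside \<open>S\<close> contribute 1. The values 1, 2 and \<open>1 + \<delta>\<close> of
  \<open>a\<close> later give total mass, membership probability and the tail bound.\<close>

lemma bernoulli_generating_function:
  assumes "finite V" "S \<subseteq> V"
  shows "(\<Sum>X\<in>Pow V. bernoulli_weight p V X * a ^ card (S \<inter> X)) = (1 + p * (a - 1)) ^ card S"
proof -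
  define f where "f x = p * (if x \<in> S then a else 1)" for x
  have "(\<Prod>x\<in>V. f x + (1 - p)) = (\<Prod>x\<in>S. 1 + p * (a - 1))"
    using assms by (intro prod.mono_neutral_cong_right) (auto simp: f_def algebra_simps)
  moreover have f: "prod f X = p ^ card X * a ^ card (S \<inter> X)" if "X \<in> Pow V" for X
  proof -
    have "finite X" using that assms(1) finite_subset by blast
    moreover from this have "(\<Prod>x\<in>X. if x \<in> S then a else 1) = (\<Prod>x\<in>S \<inter> X. a)"
      by (simp add: prod.If_cases Int_def conj_commute)
    ultimately show ?thesis by (simp add: f_def prod.distrib)
  qed
  moreover have "(\<Sum>X\<in>Pow V. bernoulli_weight p V X * a ^ card (S \<inter> X))
      = (\<Sum>X\<in>Pow V. prod f X * (1 - p) ^ card (V - X))"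
    by (intro sum.cong refl) (simp add: f bernoulli_weight_def)
  ultimately show ?thesis
    using prod_add[OF assms(1), of f "\<lambda>_. 1 - p"] by simp
qed

lemma sum_bernoulli_weight:
  assumes "finite V"
  shows "(\<Sum>X\<in>Pow V. bernoulli_weight p V X) = 1"
  using bernoulli_generating_function[OF assms, of "{}" p 1] by simp

lemma bernoulli_weight_mem:
  assumes "finite V" "v \<in> V"
  shows "(\<Sum>X\<in>Pow V. bernoulli_weight p V X * of_bool (v \<in> X)) = p"
proof -
  \<comment> \<open>The power is 1 plus the indicator of \<open>v \<in> X\<close>.\<close>
  have "(\<Sum>X\<in>Pow V. bernoulli_weight p V X * 2 ^ card ({v} \<inter> X))
      = (\<Sum>X\<in>Pow V. bernoulli_weight p V X + bernoulli_weight p V X * of_bool (v \<in> X))"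
    by (intro sum.cong) auto
  then show ?thesis
    using bernoulli_generating_function[OF assms(1), of "{v}" p 2] assms
    by (simp add: sum.distrib sum_bernoulli_weight)
qed

lemma bernoulli_expected_card:
  assumes "finite V"
  shows "(\<Sum>X\<in>Pow V. bernoulli_weight p V X * card X) = p * card V"
proof -
  have "real (card X) = (\<Sum>v\<in>V. of_bool (v \<in> X))" if "X \<in> Pow V" for X
    using that assms by (simp add: of_bool_def sum.If_cases Int_absorb1)
  then have "(\<Sum>X\<in>Pow V. bernoulli_weight p V X * card X)
      = (\<Sum>X\<in>Pow V. \<Sum>v\<in>V. bernoulli_weight p V X * of_bool (v \<in> X))"
    by (intro sum.cong refl) (simp flip: sum_distrib_left)
  also have "\<dots> = (\<Sum>v\<in>V. p)"
    by (subst sum.swap) (intro sum.cong refl bernoulli_weight_mem assms)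
  finally show ?thesis by simp
qed

text \<open>Markov's inequality for \<open>(1 + \<delta>) ^ card (S \<inter> X)\<close>. The
  exponent is at most \<open>\<delta> * (1 - 2 * \<delta>) * k - (\<delta> - \<delta>\<^sup>2) *
  k\<close>, which is \<open>- k * \<delta>\<^sup>2\<close>.\<close>

lemma bernoulli_chernoff:
  fixes \<delta> p :: real and k :: nat
  assumes V: "finite V" "S \<subseteq> V"
    and p: "0 \<le> p" "p \<le> 1" and \<delta>: "0 \<le> \<delta>" "\<delta> \<le> 1"
    and mean: "p * card S \<le> (1 - 2 * \<delta>) * k"
  shows "(\<Sum>X\<in>Pow V. bernoulli_weight p V X * of_bool (k < card (S \<inter> X))) \<le> exp (- real k * \<delta>\<^sup>2)"
proof -
  have "(\<Sum>X\<in>Pow V. bernoulli_weight p V X * of_bool (k < card (S \<inter> X)))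
      \<le> (\<Sum>X\<in>Pow V. bernoulli_weight p V X * ((1 + \<delta>) ^ card (S \<inter> X) / (1 + \<delta>) ^ k))"
    using p \<delta>
    by (intro sum_mono mult_left_mono bernoulli_weight_nonneg)
       (auto simp: of_bool_def intro: power_increasing)
  also have "\<dots> = (1 + p * \<delta>) ^ card S / (1 + \<delta>) ^ k"
    using bernoulli_generating_function[OF V, of p "1 + \<delta>"]
    by (simp flip: sum_divide_distrib)
  \<comment> \<open>Numerator by \<open>1 + x \<le> exp x\<close>, denominator by
    \<open>ln (1 + \<delta>) \<ge> \<delta> - \<delta>\<^sup>2\<close> on [0, 1].\<close>
  also have "\<dots> \<le> exp (p * \<delta>) ^ card S / exp (\<delta> - \<delta>\<^sup>2) ^ k"
  proof -
    have "exp (\<delta> - \<delta>\<^sup>2) \<le> 1 + \<delta>"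
      using ln_one_plus_pos_lower_bound[of \<delta>] \<delta> by (simp add: ln_ge_iff)
    then show ?thesis
      using p \<delta> by (intro frac_le power_mono) auto
  qed
  also have "\<dots> = exp (card S * (p * \<delta>) - k * (\<delta> - \<delta>\<^sup>2))"
    by (simp only: exp_diff exp_of_nat_mult)
  also have "\<dots> \<le> exp (- real k * \<delta>\<^sup>2)"
    using mult_right_mono[OF mean \<delta>(1)] by (simp add: algebra_simps power2_eq_square)
  finally show ?thesis .
qed

lemma card_le_limited_packing_number:
  assumes "finite (pverts G)" "limited_packing k G X"
  shows "card X \<le> limited_packing_number k G"
proof -
  have "finite {X. limited_packing k G X}"
    using assms(1) by (auto simp: limited_packing_def intro: finite_subset[of _ "Pow (pverts G)"])
  then have "finite {card X | X. limited_packing k G X}" by simp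
  then show ?thesis
    unfolding limited_packing_number_def using assms(2) by (intro Max_ge) auto
qed

section \<open>Alteration in graphs of bounded degree\<close>

context pair_graph
begin

lemma closed_nbhd_subset: "v \<in> pverts G \<Longrightarrow> closed_nbhd G v \<subseteq> pverts G"
  by (auto simp: closed_nbhd_def dest: in_arcsD2)

lemma card_closed_nbhd_le:
  assumes "v \<in> pverts G" "max_degree G \<le> d"
  shows "card (closed_nbhd G v) \<le> d + 1"
proof -
  have "out_arcs (with_proj G) v = Pair v ` {u. (v, u) \<in> parcs G}"
    by (auto simp: out_arcs_def)
  then have "card {u. (v, u) \<in> parcs G} = out_degree (with_proj G) v"
    by (simp add: out_degree_def card_image inj_on_def)
  also have "\<dots> \<le> max_degree G"
    unfolding max_degree_def using assms(1) finite_verts by (intro Max_ge) auto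
  finally show ?thesis
    \<comment> \<open>In the infinite case \<open>card\<close> is 0.\<close>
    unfolding closed_nbhd_def using assms(2)
    by (cases "finite {u. (v, u) \<in> parcs G}") (simp_all add: card_insert_if)
qed

text \<open>Deleting the closed neighbourhoods of all overloaded vertices empties these
  neighbourhoods and only lowers the other counts, at a cost of at most \<open>d + 1\<close> points
  per overloaded vertex. The additive form avoids truncated subtraction.\<close>

lemma limited_packing_alteration:
  assumes "X \<subseteq> pverts G" "max_degree G \<le> d"
  shows "card X \<le> limited_packing_number k G
    + (d + 1) * card {v \<in> pverts G. k < card (closed_nbhd G v \<inter> X)}"
proof -
  define B where "B = {v \<in> pverts G. k < card (closed_nbhd G v \<inter> X)}"
  define D where "D = (\<Union>v\<in>B. closed_nbhd G v)"
  have B: "finite B" "B \<subseteq> pverts G" by (auto simp: B_def)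
  have fin: "finite (closed_nbhd G v)" if "v \<in> pverts G" for v
    using closed_nbhd_subset[OF that] pair_finite_verts finite_subset by blast
  have "card (closed_nbhd G v \<inter> (X - D)) \<le> k" if v: "v \<in> pverts G" for v
  proof (cases "v \<in> B")
    case True
    then have "closed_nbhd G v \<inter> (X - D) = {}" by (auto simp: D_def)
    then show ?thesis by simp
  next
    case False
    moreover have "card (closed_nbhd G v \<inter> (X - D)) \<le> card (closed_nbhd G v \<inter> X)"
      using fin[OF v] by (intro card_mono) auto
    ultimately show ?thesis using v by (simp add: B_def)
  qed
  then have "limited_packing k G (X - D)"
    using assms(1) by (auto simp: limited_packing_def)
  then have "card (X - D) \<le> limited_packing_number k G"
    by (intro card_le_limited_packing_number) auto
  moreover have "card D \<le> (d + 1) * card B"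
  proof -
    have "card D \<le> (\<Sum>v\<in>B. card (closed_nbhd G v))"
      unfolding D_def by (rule card_UN_le[OF B(1)])
    also have "\<dots> \<le> of_nat (card B) * (d + 1)"
      using B(2) card_closed_nbhd_le[OF _ assms(2)] by (intro sum_bounded_above) auto
    finally show ?thesis by (simp add: mult.commute)
  qed
  moreover have "card X \<le> card (X - D) + card D"
  proof -
    have "finite D" using B fin by (auto simp: D_def)
    then show ?thesis using diff_card_le_card_Diff[of D X] by linarith
  qed
  ultimately show ?thesis by (simp add: B_def)
qed

text \<open>Averages the alteration bound over random \<open>X\<close>. The packing number is
  constant in \<open>X\<close>, so no particular good \<open>X\<close> has to be selected.\<close>

lemma limited_packing_number_ge:
  fixes \<delta> :: real
  assumes d: "max_degree G \<le> d" and k: "k \<le> d + 1" and \<delta>: "0 \<le> \<delta>" "2 * \<delta> \<le> 1"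
  shows "card (pverts G) * (k * (1 - 2 * \<delta>) / (d + 1) - (d + 1) * exp (- real k * \<delta>\<^sup>2))
    \<le> limited_packing_number k G"
proof -
  define V where "V = pverts G"
  \<comment> \<open>As closed neighbourhoods have at most \<open>d + 1\<close> points, their mean
    load is at most \<open>(1 - 2 * \<delta>) * k\<close>; \<open>k \<le> d + 1\<close> ensures
    \<open>p \<le> 1\<close>.\<close>
  define p where "p = k * (1 - 2 * \<delta>) / (d + 1)"
  define bad where "bad X v = (of_bool (k < card (closed_nbhd G v \<inter> X)) :: real)" for X v
  let ?w = "bernoulli_weight p V" and ?L = "real (limited_packing_number k G)"
  have V: "finite V" by (simp add: V_def)
  have "k * (1 - 2 * \<delta>) \<le> real (d + 1) * 1"
    using k \<delta> by (intro mult_mono) auto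
  then have p: "0 \<le> p" "p \<le> 1"
    using \<delta> by (simp_all add: p_def divide_le_eq)
  have bad: "(\<Sum>X\<in>Pow V. ?w X * bad X v) \<le> exp (- real k * \<delta>\<^sup>2)" if v: "v \<in> V" for v
    unfolding bad_def
  proof (rule bernoulli_chernoff)
    have "p * card (closed_nbhd G v) \<le> p * (d + 1)"
      using card_closed_nbhd_le[OF _ d, of v] v p by (intro mult_left_mono) (auto simp: V_def)
    then show "p * card (closed_nbhd G v) \<le> (1 - 2 * \<delta>) * k"
      by (simp add: p_def mult.commute)
  qed (use V p \<delta> v closed_nbhd_subset in \<open>auto simp: V_def\<close>)
  have alteration: "real (card X) \<le> ?L + (d + 1) * (\<Sum>v\<in>V. bad X v)" if "X \<in> Pow V" for X
  proof -
    have "(\<Sum>v\<in>V. bad X v) = card {v \<in> V. k < card (closed_nbhd G v \<inter> X)}"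
      using V by (simp add: bad_def of_bool_def sum.If_cases Int_def)
    moreover have "real (card X) \<le> real (limited_packing_number k G
        + (d + 1) * card {v \<in> pverts G. k < card (closed_nbhd G v \<inter> X)})"
      using that by (intro of_nat_mono limited_packing_alteration d) (auto simp: V_def)
    ultimately show ?thesis by (simp add: V_def algebra_simps)
  qed
  have "p * card V = (\<Sum>X\<in>Pow V. ?w X * card X)"
    by (simp add: bernoulli_expected_card V)
  also have "\<dots> \<le> (\<Sum>X\<in>Pow V. ?w X * (?L + (d + 1) * (\<Sum>v\<in>V. bad X v)))"
    using alteration p by (intro sum_mono mult_left_mono bernoulli_weight_nonneg)
  also have "\<dots> = ?L * (\<Sum>X\<in>Pow V. ?w X) + (d + 1) * (\<Sum>X\<in>Pow V. \<Sum>v\<in>V. ?w X * bad X v)"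
    by (simp add: sum_distrib_left sum_distrib_right sum.distrib algebra_simps)
  also have "\<dots> = ?L + (d + 1) * (\<Sum>v\<in>V. \<Sum>X\<in>Pow V. ?w X * bad X v)"
    by (subst sum.swap) (simp add: sum_bernoulli_weight V)
  also have "\<dots> \<le> ?L + (d + 1) * (\<Sum>v\<in>V. exp (- real k * \<delta>\<^sup>2))"
    using bad by (intro add_left_mono mult_left_mono sum_mono) auto
  finally show ?thesis by (simp add: p_def V_def algebra_simps)
qed

end

section \<open>Choice of \<delta> and asymptotics\<close>

text \<open>The threshold 16 is where \<open>2 * \<delta> \<le> 1\<close> begins to hold for
  \<open>\<delta> = ln (ln d) powr (-1/4)\<close>. Below it the error 1 makes the claimed bound
  0.\<close>

definition packing_error :: "nat \<Rightarrow> real" where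
  "packing_error d = (if ln (ln d) < 16 then 1
     else 1 - (1 - 2 * ln (ln d) powr (-1/4)) * d / (d + 1)
        + d * (d + 1) * exp (- ln d * sqrt (ln (ln d))))"

text \<open>The last term has order \<open>d powr (2 - sqrt (ln (ln d)))\<close>.\<close>

lemma packing_error_tendsto: "packing_error \<longlonglongrightarrow> 0"
proof -
  have "(\<lambda>d. 1 - (1 - 2 * ln (ln (real d)) powr (-1/4)) * real d / (real d + 1)
        + real d * (real d + 1) * exp (- ln (real d) * sqrt (ln (ln (real d))))) \<longlonglongrightarrow> 0"
    by real_asymp
  moreover have "\<forall>\<^sub>F d::nat in sequentially. 16 \<le> ln (ln (real d))"
    by real_asymp
  ultimately show ?thesis
    by (elim Lim_transform_eventually eventually_mono) (auto simp: packing_error_def)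
qed

lemma (in pair_graph) limited_packing_number_ge_packing_error:
  assumes k: "1 \<le> k" "ln (real d) * ln (ln (real d)) < k" "k \<le> d + 1"
    and d: "max_degree G \<le> d"
  shows "real k * card (pverts G) / d * (1 - packing_error d) \<le> limited_packing_number k G"
proof (cases "ln (ln (real d)) < 16")
  case True
  then show ?thesis by (simp add: packing_error_def)
next
  case False
  define l where "l = ln (ln (real d))"
  \<comment> \<open>This \<delta> tends to 0 while \<open>l * \<delta>\<^sup>2 = sqrt l\<close> is
    unbounded, so the tail beats every fixed power of \<open>d\<close>.\<close>
  define \<delta> where "\<delta> = l powr (-1/4)"
  define n where "n = card (pverts G)"
  have l: "l \<ge> 16" using False by (simp add: l_def)
  \<comment> \<open>Uses the convention \<open>ln 0 = 0\<close>.\<close>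
  have "d \<noteq> 0" using l by (intro notI) (simp add: l_def)
  then have d0: "real d > 0" by simp
  have \<delta>sq: "\<delta>\<^sup>2 = 1 / sqrt l"
    using l powr_power[of l "-1/4" 2] powr_minus_divide[of l "1/2"]
    by (simp add: \<delta>_def powr_half_sqrt)
  have "2 * \<delta> \<le> 1"
  proof (rule power2_le_imp_le)
    have "sqrt 16 \<le> sqrt l" using l by (intro real_sqrt_le_mono)
    then have "1 / sqrt l \<le> 1 / 4" using l by (intro divide_left_mono) auto
    then show "(2 * \<delta>)\<^sup>2 \<le> 1\<^sup>2" by (simp add: power_mult_distrib \<delta>sq)
  qed simp
  then have main: "n * (k * (1 - 2 * \<delta>) / (real d + 1) - (real d + 1) * exp (- real k * \<delta>\<^sup>2))
      \<le> limited_packing_number k G"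
    unfolding n_def using k(3) d by (intro limited_packing_number_ge) (auto simp: \<delta>_def)
  have "ln d * l * \<delta>\<^sup>2 \<le> k * \<delta>\<^sup>2"
    using k(2) by (intro mult_right_mono) (auto simp: l_def)
  moreover have "l * \<delta>\<^sup>2 = sqrt l"
    using l by (simp add: \<delta>sq real_div_sqrt)
  ultimately have "exp (- real k * \<delta>\<^sup>2) \<le> exp (- ln d * sqrt l)"
    by (simp add: mult.assoc)
  \<comment> \<open>The extra factor \<open>k\<close> lets \<open>k\<close> be pulled out of the
    whole bound, so the error depends on \<open>d\<close> alone.\<close>
  also have "\<dots> \<le> k * exp (- ln d * sqrt l)"
    using k(1) by simp
  finally have "n * (k * (1 - 2 * \<delta>) / (real d + 1) - (real d + 1) * (k * exp (- ln d * sqrt l)))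
      \<le> n * (k * (1 - 2 * \<delta>) / (real d + 1) - (real d + 1) * exp (- real k * \<delta>\<^sup>2))"
    by (intro mult_left_mono diff_left_mono) auto
  moreover have "real k * n / d * (1 - packing_error d)
      = n * (k * (1 - 2 * \<delta>) / (real d + 1) - (real d + 1) * (k * exp (- ln d * sqrt l)))"
  proof -
    have "1 - packing_error d = d * ((1 - 2 * \<delta>) / (real d + 1) - (real d + 1) * exp (- ln d * sqrt l))"
      using False by (simp add: packing_error_def \<delta>_def l_def algebra_simps)
    then have "real k * n / d * (1 - packing_error d)
        = k * n * ((1 - 2 * \<delta>) / (real d + 1) - (real d + 1) * exp (- ln d * sqrt l))"
      using d0 by simp
    then show ?thesis by (simp add: algebra_simps)
  qed
  ultimately show ?thesis using main by (simp add: n_def)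
qed

text \<open>Once \<open>k\<close> exceeds \<open>\<Delta> + 1\<close> the whole vertex set is a
  packing, so the packing number stops growing while the bound stays linear in \<open>k\<close>;
  hence the range of \<open>k\<close>.\<close>

theorem theorem3p2:
  shows "\<exists>\<epsilon> :: nat \<Rightarrow> real. \<epsilon> \<longlonglongrightarrow> 0 \<and>
    (\<forall>(\<Delta>::nat) (k::nat) (G :: nat pair_pre_digraph).
       k \<ge> 1 \<longrightarrow> real k > ln (real \<Delta>) * ln (ln (real \<Delta>)) \<longrightarrow> k \<le> \<Delta> + 1 \<longrightarrow>
       pair_graph G \<longrightarrow> max_degree G \<le> \<Delta> \<longrightarrow>
       real (limited_packing_number k G)
         \<ge> real k * real (card (pverts G)) / real \<Delta> * (1 - \<epsilon> \<Delta>))"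
  using packing_error_tendsto pair_graph.limited_packing_number_ge_packing_error by blast

end
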